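(* Let $t\in\mathbb N$, $\mathbb F_q$ of characteristic $2$, and for $i\in[t]$ let $\mathcal C_i=(C_i,\partial_i)$ be single-sector chain complexes with $n_i=\dim C_i$; let $\rho_i$ be the product-expansion of $(B_*(\mathcal C_1),\dots,B_*(\mathcal C_{i-1}),Z_*(\mathcal C_i))$. Let $$a\in\bigotimes_{i\in[t]}Z_*(\mathcal C_i)+\sum_{i\in[t]}B_*(\mathcal C_i)^{(i)}\subseteq C_1\otimes\cdots\otimes C_t,$$ and suppose there exist $z^i\in Z^*(\mathcal C_i)$, $i\in[t]$, with $\left(\bigotimes_{i\in[t]}z^i\right)\cdot a\neq0$. Then $|a|\ge\prod_{i\in[t]}(\rho_in_i)$.
   Context: Product-expansion: For codes $C_1\subseteq\mathbb F_q^{n_1},\dots,C_t\subseteq\mathbb F_q^{n_t}$, identify $\mathbb F_q^{n_1}\otimes\cdots\otimes\mathbb F_q^{n_t}$ with $t$-dimensional arrays; a direction-$i$ column is the vector in $\mathbb F_q^{n_i}$ obtained by fixing all coordinates except the $i$-th. $C^{(i)}$ is the space of arrays all of whose direction-$i$ columns lie in $C_i$, and $C_1\boxplus\cdots\boxplus C_t=C^{(1)}+\cdots+C^{(t)}$. $|c|$ is the number of nonzero entries, $|c|_i$ the number of nonzero direction-$i$ columns. The product-expansion of $(C_i)_{i\in[t]}$ is the largest $\rho\ge0$ such that every $c\in C_1\boxplus\cdots\boxplus C_t$ has a decomposition $c=c_1+\cdots+c_t$ with $c_i\in C^{(i)}$ and $|c|\ge\rho\sum_in_i|c_i|_i$.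 For a subspace $V\subseteq C_i$, $V^{(i)}$ similarly denotes arrays in $C_1\otimes\cdots\otimes C_t$ all of whose direction-$i$ columns lie in $V$. Single-sector complex: $\mathcal C=(C,\partial)$ with $C=\mathbb F_q^n$, $\partial^2=0$; $Z_*=\ker\partial$, $B_*=\operatorname{im}\partial$, $Z^*=\ker\partial^\top$. The dot product on arrays is the standard entrywise bilinear form. *)

theory Defs
  imports Complex_Main
begin

definition vecs :: "nat \<Rightarrow> (nat \<Rightarrow> 'a::zero) set" where
  "vecs n = {v. \<forall>j\<ge>n. v j = 0}"

definition matvec :: "nat \<Rightarrow> (nat \<Rightarrow> nat \<Rightarrow> 'a::comm_semiring_0) \<Rightarrow> (nat \<Rightarrow> 'a) \<Rightarrow> (nat \<Rightarrow> 'a)" where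
  "matvec n D v = (\<lambda>j. if j < n then (\<Sum>k<n. D j k * v k) else 0)"

definition transp_mat :: "(nat \<Rightarrow> nat \<Rightarrow> 'a) \<Rightarrow> (nat \<Rightarrow> nat \<Rightarrow> 'a)" where
  "transp_mat D = (\<lambda>j k. D k j)"

definition is_complex :: "nat \<Rightarrow> (nat \<Rightarrow> nat \<Rightarrow> 'a::comm_semiring_0) \<Rightarrow> bool" where
  "is_complex n D \<longleftrightarrow> (\<forall>v\<in>vecs n. matvec n D (matvec n D v) = (\<lambda>_. 0))"

definition Zlow :: "nat \<Rightarrow> (nat \<Rightarrow> nat \<Rightarrow> 'a::comm_semiring_0) \<Rightarrow> (nat \<Rightarrow> 'a) set" where
  "Zlow n D = {v\<in>vecs n. matvec n D v = (\<lambda>_. 0)}"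

definition Blow :: "nat \<Rightarrow> (nat \<Rightarrow> nat \<Rightarrow> 'a::comm_semiring_0) \<Rightarrow> (nat \<Rightarrow> 'a) set" where
  "Blow n D = matvec n D ` vecs n"

definition Zup :: "nat \<Rightarrow> (nat \<Rightarrow> nat \<Rightarrow> 'a::comm_semiring_0) \<Rightarrow> (nat \<Rightarrow> 'a) set" where
  "Zup n D = {v\<in>vecs n. matvec n (transp_mat D) v = (\<lambda>_. 0)}"

text \<open>t-dimensional arrays of shape n 0 x ... x n (t-1): index tuples are functions
  nat => nat with x i < n i for i < t and x i = 0 for i >= t.\<close>
definition box :: "nat \<Rightarrow> (nat \<Rightarrow> nat) \<Rightarrow> (nat \<Rightarrow> nat) set" where
  "box t n = {x. (\<forall>i<t. x i < n i) \<and> (\<forall>i\<ge>t. x i = 0)}"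

definition arrays :: "nat \<Rightarrow> (nat \<Rightarrow> nat) \<Rightarrow> ((nat \<Rightarrow> nat) \<Rightarrow> 'a::zero) set" where
  "arrays t n = {f. \<forall>x. x \<notin> box t n \<longrightarrow> f x = 0}"

definition col :: "(nat \<Rightarrow> nat) \<Rightarrow> ((nat \<Rightarrow> nat) \<Rightarrow> 'a::zero) \<Rightarrow> nat \<Rightarrow> (nat \<Rightarrow> nat) \<Rightarrow> (nat \<Rightarrow> 'a)" where
  "col n f i x = (\<lambda>j. if j < n i then f (x(i := j)) else 0)"

definition colspace :: "nat \<Rightarrow> (nat \<Rightarrow> nat) \<Rightarrow> nat \<Rightarrow> (nat \<Rightarrow> 'a::zero) set \<Rightarrow> ((nat \<Rightarrow> nat) \<Rightarrow> 'a) set" where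
  "colspace t n i V = {f\<in>arrays t n. \<forall>x\<in>box t n. col n f i x \<in> V}"

definition subsum :: "nat \<Rightarrow> (nat \<Rightarrow> ((nat \<Rightarrow> nat) \<Rightarrow> 'a::comm_monoid_add) set) \<Rightarrow> ((nat \<Rightarrow> nat) \<Rightarrow> 'a) set" where
  "subsum t S = {f. \<exists>g. (\<forall>i<t. g i \<in> S i) \<and> f = (\<lambda>x. \<Sum>i<t. g i x)}"

definition etensor :: "nat \<Rightarrow> (nat \<Rightarrow> nat) \<Rightarrow> (nat \<Rightarrow> nat \<Rightarrow> 'a::comm_semiring_1) \<Rightarrow> ((nat \<Rightarrow> nat) \<Rightarrow> 'a)" where
  "etensor t n z = (\<lambda>x. if x \<in> box t n then (\<Prod>i<t. z i (x i)) else 0)"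

text \<open>Tensor product of codes V 0 \<otimes> ... \<otimes> V (t-1): the span of elementary tensors
  (scalars are absorbed into a factor, codes being subspaces).\<close>
definition tensor_space :: "nat \<Rightarrow> (nat \<Rightarrow> nat) \<Rightarrow> (nat \<Rightarrow> (nat \<Rightarrow> 'a::comm_semiring_1) set) \<Rightarrow> ((nat \<Rightarrow> nat) \<Rightarrow> 'a) set" where
  "tensor_space t n V = {f. \<exists>(m::nat) zs. (\<forall>k<m. \<forall>i<t. zs k i \<in> V i) \<and>
       f = (\<lambda>x. \<Sum>k<m. etensor t n (zs k) x)}"

definition dot :: "nat \<Rightarrow> (nat \<Rightarrow> nat) \<Rightarrow> ((nat \<Rightarrow> nat) \<Rightarrow> 'a::comm_semiring_0) \<Rightarrow> ((nat \<Rightarrow> nat) \<Rightarrow> 'a) \<Rightarrow> 'a" where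
  "dot t n f g = (\<Sum>x\<in>box t n. f x * g x)"

definition weight :: "nat \<Rightarrow> (nat \<Rightarrow> nat) \<Rightarrow> ((nat \<Rightarrow> nat) \<Rightarrow> 'a::zero) \<Rightarrow> nat" where
  "weight t n c = card {x\<in>box t n. c x \<noteq> 0}"

definition colweight :: "nat \<Rightarrow> (nat \<Rightarrow> nat) \<Rightarrow> nat \<Rightarrow> ((nat \<Rightarrow> nat) \<Rightarrow> 'a::zero) \<Rightarrow> nat" where
  "colweight t n i c = card {x\<in>box t n. x i = 0 \<and> col n c i x \<noteq> (\<lambda>_. 0)}"

definition pe_good :: "nat \<Rightarrow> (nat \<Rightarrow> nat) \<Rightarrow> (nat \<Rightarrow> (nat \<Rightarrow> 'a::{comm_monoid_add}) set) \<Rightarrow> real \<Rightarrow> bool" where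
  "pe_good t n V \<rho> \<longleftrightarrow> 0 \<le> \<rho> \<and>
     (\<forall>c\<in>subsum t (\<lambda>i. colspace t n i (V i)).
        \<exists>cs. (\<forall>i<t. cs i \<in> colspace t n i (V i)) \<and> c = (\<lambda>x. \<Sum>i<t. cs i x) \<and>
             real (weight t n c) \<ge> \<rho> * (\<Sum>i<t. real (n i) * real (colweight t n i (cs i))))"

definition product_expansion :: "nat \<Rightarrow> (nat \<Rightarrow> nat) \<Rightarrow> (nat \<Rightarrow> (nat \<Rightarrow> 'a::{comm_monoid_add}) set) \<Rightarrow> real" where
  "product_expansion t n V = Sup {\<rho>. pe_good t n V \<rho>}"

end

theory Submission
  imports Defs
begin

text \<open>
  Induction on \<open>t\<close>, contracting the last direction against \<open>z\<^sub>t\<close>. Since \<open>B\<^sub>t \<subseteq> Z\<^sub>t\<close>,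
  the array \<open>a\<close> lies in the product code of \<open>B\<^sub>1, \<dots>, B\<^sub>t\<^sub>-\<^sub>1, Z\<^sub>t\<close>, so product-expansion
  decomposes \<open>a = c\<^sub>1 + \<dots> + c\<^sub>t\<close> with \<open>|a| \<ge> \<rho>\<^sub>t n\<^sub>t |c\<^sub>t|\<^sub>t\<close>. Let \<open>b\<close> be the contraction of
  \<open>c\<^sub>t\<close> against \<open>z\<^sub>t\<close>. As \<open>z\<^sub>i\<close> is orthogonal to \<open>B\<^sub>i\<close>, the \<open>c\<^sub>i\<close> with \<open>i < t\<close> do not pair
  with \<open>z\<^sub>1 \<otimes> \<dots> \<otimes> z\<^sub>t\<close>, hence \<open>b\<close> pairs nontrivially with \<open>z\<^sub>1 \<otimes> \<dots> \<otimes> z\<^sub>t\<^sub>-\<^sub>1\<close>; and \<open>b\<close>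
  differs from the contraction of \<open>a\<close> by contractions of these \<open>c\<^sub>i\<close>, so it lies in the
  analogous space of dimension \<open>t - 1\<close>. Each nonzero entry of \<open>b\<close> comes from a nonzero
  direction-\<open>t\<close> column of \<open>c\<^sub>t\<close>, so \<open>|b| \<le> |c\<^sub>t|\<^sub>t\<close>, and the induction hypothesis for \<open>b\<close>
  gives the bound.
\<close>

lemma bij_betw_box_update:
  assumes "i < t"
  shows "bij_betw (\<lambda>(y, j). y(i := j)) (box t (n(i := 1)) \<times> {..<n i}) (box t n)"
proof (rule bij_betwI')
  fix p q assume p: "p \<in> box t (n(i := 1)) \<times> {..<n i}" and q: "q \<in> box t (n(i := 1)) \<times> {..<n i}"
  obtain y j y' j' where pq: "p = (y, j)" "q = (y', j')" by force
  have "y i = 0" "y' i = 0" using p q pq assms by (auto simp: box_def)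
  show "((\<lambda>(y, j). y(i := j)) p = (\<lambda>(y, j). y(i := j)) q) = (p = q)"
  proof
    assume "(\<lambda>(y, j). y(i := j)) p = (\<lambda>(y, j). y(i := j)) q"
    then have eq: "y(i := j) = y'(i := j')" using pq by simp
    have "y = y'"
    proof
      fix l show "y l = y' l"
        using fun_cong[OF eq, of l] \<open>y i = 0\<close> \<open>y' i = 0\<close> by (cases "l = i") auto
    qed
    with fun_cong[OF eq, of i] show "p = q" using pq by simp
  qed simp
next
  fix p assume "p \<in> box t (n(i := 1)) \<times> {..<n i}"
  then show "(\<lambda>(y, j). y(i := j)) p \<in> box t n"
    using assms by (auto simp: box_def split: prod.splits)
next
  fix x assume "x \<in> box t n"
  then show "\<exists>p\<in>box t (n(i := 1)) \<times> {..<n i}. x = (\<lambda>(y, j). y(i := j)) p"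
    using assms by (intro bexI[of _ "(x(i := 0), x i)"]) (auto simp: box_def)
qed

lemma sum_box_split:
  assumes "i < t"
  shows "(\<Sum>x\<in>box t n. g x) = (\<Sum>y\<in>box t (n(i := 1)). \<Sum>j<n i. g (y(i := j)))"
proof -
  have "(\<Sum>x\<in>box t n. g x) = (\<Sum>p\<in>box t (n(i := 1)) \<times> {..<n i}. g ((\<lambda>(y, j). y(i := j)) p))"
    using sum.reindex_bij_betw[OF bij_betw_box_update[OF assms], of g] by simp
  also have "\<dots> = (\<Sum>y\<in>box t (n(i := 1)). \<Sum>j<n i. g (y(i := j)))"
    by (simp add: sum.cartesian_product split_def)
  finally show ?thesis .
qed

lemma box_Suc_last: "box (Suc k) (n(k := 1)) = box k n"
  unfolding box_def
proof (intro Collect_cong iffI conjI allI impI)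
  fix x i assume "(\<forall>i<Suc k. x i < (n(k := 1)) i) \<and> (\<forall>i\<ge>Suc k. x i = 0)"
  then show "i \<ge> k \<Longrightarrow> x i = 0" by (cases "i = k") auto
qed (auto simp: less_Suc_eq)

lemma sum_box_Suc: "(\<Sum>x\<in>box (Suc k) n. g x) = (\<Sum>y\<in>box k n. \<Sum>j<n k. g (y(k := j)))"
  by (subst sum_box_split[OF lessI]) (simp only: box_Suc_last)

lemma finite_box: "finite (box t n)"
proof (induction t)
  case 0
  have "box 0 n \<subseteq> {\<lambda>_. 0}" by (auto simp: box_def)
  then show ?case using finite_subset by blast
next
  case (Suc k)
  have "box (Suc k) n = (\<lambda>(y, j). y(k := j)) ` (box k n \<times> {..<n k})"
    using bij_betw_imp_surj_on[OF bij_betw_box_update[of k "Suc k" n]] box_Suc_last by simp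
  then show ?case using Suc by simp
qed

lemma box_update_Suc: "y \<in> box k n \<Longrightarrow> l < n k \<Longrightarrow> y(k := l) \<in> box (Suc k) n"
  by (auto simp: box_def)

lemma weight_pos_if_dot_nonzero:
  assumes "dot t n e b \<noteq> 0"
  shows "0 < weight t n b"
proof -
  obtain x where "x \<in> box t n" "b x \<noteq> 0"
    using assms unfolding dot_def by (metis (mono_tags, lifting) mult_zero_right sum.neutral)
  then show ?thesis
    unfolding weight_def using finite_box by (subst card_gt_0_iff) auto
qed

lemma dim_pos_if_dot_nonzero:
  assumes "dot t n e b \<noteq> 0" "i < t"
  shows "0 < n i"
proof -
  obtain x where "x \<in> box t n"
    using assms(1) unfolding dot_def by fastforce
  then show ?thesis using assms(2) by (auto simp: box_def)
qed

definition linear_subspace :: "(nat \<Rightarrow> 'a::comm_ring_1) set \<Rightarrow> bool" where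
  "linear_subspace V \<longleftrightarrow> (\<lambda>_. 0) \<in> V \<and> (\<forall>v\<in>V. \<forall>w\<in>V. (\<lambda>j. v j + w j) \<in> V) \<and>
     (\<forall>c. \<forall>v\<in>V. (\<lambda>j. c * v j) \<in> V)"

lemma linear_subspace_zero: "linear_subspace V \<Longrightarrow> (\<lambda>_. 0) \<in> V"
  and linear_subspace_add: "linear_subspace V \<Longrightarrow> v \<in> V \<Longrightarrow> w \<in> V \<Longrightarrow> (\<lambda>j. v j + w j) \<in> V"
  and linear_subspace_smult: "linear_subspace V \<Longrightarrow> v \<in> V \<Longrightarrow> (\<lambda>j. c * v j) \<in> V"
  by (simp_all add: linear_subspace_def)

lemma linear_subspace_diff:
  assumes "linear_subspace V" "v \<in> V" "w \<in> V"
  shows "(\<lambda>j. v j - w j) \<in> V"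
  using linear_subspace_add[OF assms(1,2) linear_subspace_smult[OF assms(1,3), of "- 1"]] by simp

lemma linear_subspace_sum: "linear_subspace V \<Longrightarrow> (\<And>m. m \<in> M \<Longrightarrow> f m \<in> V) \<Longrightarrow> (\<lambda>j. \<Sum>m\<in>M. f m j) \<in> V"
proof (induction M rule: infinite_finite_induct)
  case (insert x F)
  then show ?case using linear_subspace_add[of V "f x" "\<lambda>j. \<Sum>m\<in>F. f m j"] by simp
qed (simp_all add: linear_subspace_zero)

lemma matvec_add: "matvec N D (\<lambda>j. v j + w j) = (\<lambda>j. matvec N D v j + matvec N D w j)"
  by (auto simp: matvec_def distrib_left sum.distrib)

lemma matvec_smult: "matvec N D (\<lambda>j. c * v j) = (\<lambda>j. c * matvec N D v j)"
  by (auto simp: matvec_def sum_distrib_left algebra_simps)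

lemma linear_subspace_Zlow: "linear_subspace (Zlow N (D :: nat \<Rightarrow> nat \<Rightarrow> 'a::comm_ring_1))"
  unfolding linear_subspace_def Zlow_def
  by (auto simp: vecs_def matvec_add matvec_smult) (auto simp: matvec_def)

lemma linear_subspace_Blow: "linear_subspace (Blow N (D :: nat \<Rightarrow> nat \<Rightarrow> 'a::comm_ring_1))"
proof -
  have "(\<lambda>_. 0) = matvec N D (\<lambda>_. 0)" by (auto simp: matvec_def)
  moreover have "(\<lambda>j. matvec N D v j + matvec N D w j) = matvec N D (\<lambda>j. v j + w j)" for v w
    by (simp add: matvec_add)
  moreover have "(\<lambda>j. c * matvec N D v j) = matvec N D (\<lambda>j. c * v j)" for c v
    by (simp add: matvec_smult)
  ultimately show ?thesis
    unfolding linear_subspace_def Blow_def by (auto simp: vecs_def)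
qed

lemma Blow_subset_Zlow: "is_complex N D \<Longrightarrow> Blow N D \<subseteq> Zlow N D"
  by (auto simp: is_complex_def Blow_def Zlow_def matvec_def vecs_def)

lemma Zup_orthogonal_Blow:
  assumes "z \<in> Zup N D" "w \<in> Blow N D"
  shows "(\<Sum>l<N. z l * w l) = 0"
proof -
  obtain v where w: "w = matvec N D v" using assms(2) by (auto simp: Blow_def)
  have zD: "(\<Sum>l<N. D l m * z l) = 0" if "m < N" for m
    using that fun_cong[of _ _ m, OF assms(1)[unfolded Zup_def, THEN CollectD, THEN conjunct2]]
    by (simp add: matvec_def transp_mat_def)
  have "(\<Sum>l<N. z l * w l) = (\<Sum>l<N. \<Sum>m<N. z l * (D l m * v m))"
    by (simp add: w matvec_def sum_distrib_left)
  also have "\<dots> = (\<Sum>m<N. v m * (\<Sum>l<N. D l m * z l))"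
    by (subst sum.swap) (simp add: sum_distrib_left algebra_simps)
  also have "\<dots> = 0" using zD by simp
  finally show ?thesis .
qed

lemma col_diff: "col n (\<lambda>x. (f x :: 'a::comm_ring_1) - g x) i x = (\<lambda>j. col n f i x j - col n g i x j)"
  and col_sum: "col n (\<lambda>x. \<Sum>m\<in>M. (h m x :: 'a)) i x = (\<lambda>j. \<Sum>m\<in>M. col n (h m) i x j)"
  by (simp_all add: col_def fun_eq_iff)

lemma colspace_diff:
  "linear_subspace V \<Longrightarrow> f \<in> colspace t n i V \<Longrightarrow> g \<in> colspace t n i V \<Longrightarrow>
    (\<lambda>x. f x - g x) \<in> colspace t n i V"
  by (auto simp: colspace_def arrays_def col_diff linear_subspace_diff)

lemma colspace_sum:
  "linear_subspace V \<Longrightarrow> (\<And>m. m \<in> M \<Longrightarrow> f m \<in> colspace t n i V) \<Longrightarrow>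
    (\<lambda>x. \<Sum>m\<in>M. f m x) \<in> colspace t n i V"
  by (auto simp: colspace_def arrays_def col_sum intro!: linear_subspace_sum)

lemma colspace_mono: "V \<subseteq> W \<Longrightarrow> colspace t n i V \<subseteq> colspace t n i W"
  by (auto simp: colspace_def)

lemma col_etensor:
  assumes "i < t" "x \<in> box t n" "zs i \<in> vecs (n i)"
  shows "col n (etensor t n zs) i x = (\<lambda>j. (\<Prod>l\<in>{..<t} - {i}. zs l (x l)) * zs i j)"
proof
  fix j
  show "col n (etensor t n zs) i x j = (\<Prod>l\<in>{..<t} - {i}. zs l (x l)) * zs i j"
  proof (cases "j < n i")
    case True
    have "x(i := j) \<in> box t n" using assms True by (auto simp: box_def)
    moreover have "(\<Prod>l\<in>{..<t} - {i}. zs l ((x(i := j)) l)) = (\<Prod>l\<in>{..<t} - {i}. zs l (x l))"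
      by (rule prod.cong) auto
    ultimately show ?thesis
      using True assms(1) by (simp add: col_def etensor_def prod.remove mult.commute)
  qed (use assms(3) in \<open>simp add: col_def vecs_def\<close>)
qed

lemma etensor_colspace:
  assumes "i < t" "linear_subspace V" "V \<subseteq> vecs (n i)" "zs i \<in> V"
  shows "etensor t n zs \<in> colspace t n i V"
proof -
  have zv: "zs i \<in> vecs (n i)" using assms(3,4) by blast
  have "col n (etensor t n zs) i x \<in> V" if "x \<in> box t n" for x
    unfolding col_etensor[where zs=zs, OF assms(1) that zv] by (rule linear_subspace_smult[OF assms(2,4)])
  then show ?thesis by (simp add: colspace_def arrays_def etensor_def)
qed

lemma dot_sum: "dot t n e (\<lambda>x. \<Sum>i\<in>I. g i x) = (\<Sum>i\<in>I. dot t n e (g i))"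
  by (simp add: dot_def sum_distrib_left sum.swap[of _ I])

lemma dot_etensor_colspace_Blow:
  assumes "i < t" "z i \<in> Zup (n i) D" "f \<in> colspace t n i (Blow (n i) D)"
  shows "dot t n (etensor t n z) f = 0"
proof -
  have "(\<Sum>j<n i. etensor t n z (y(i := j)) * f (y(i := j))) = 0" if y: "y \<in> box t (n(i := 1))" for y
  proof (cases "n i = 0")
    case False
    have yb: "y \<in> box t n" using y False assms(1) by (auto simp: box_def split: if_splits)
    have zv: "z i \<in> vecs (n i)" using assms(2) by (simp add: Zup_def)
    have "etensor t n z (y(i := j)) = (\<Prod>l\<in>{..<t} - {i}. z l (y l)) * z i j" if "j < n i" for j
      using fun_cong[OF col_etensor[where zs=z, OF assms(1) yb zv], of j] that by (simp add: col_def)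
    then have "(\<Sum>j<n i. etensor t n z (y(i := j)) * f (y(i := j)))
        = (\<Prod>l\<in>{..<t} - {i}. z l (y l)) * (\<Sum>j<n i. z i j * col n f i y j)"
      by (simp add: col_def sum_distrib_left mult.assoc)
    also have "\<dots> = 0"
      using Zup_orthogonal_Blow[OF assms(2)] assms(3) yb by (simp add: colspace_def)
    finally show ?thesis .
  qed simp
  then show ?thesis
    unfolding dot_def sum_box_split[OF assms(1), where n=n] by simp
qed

definition contract_last ::
    "nat \<Rightarrow> (nat \<Rightarrow> nat) \<Rightarrow> (nat \<Rightarrow> 'a::comm_ring_1) \<Rightarrow> ((nat \<Rightarrow> nat) \<Rightarrow> 'a) \<Rightarrow> (nat \<Rightarrow> nat) \<Rightarrow> 'a"
  where "contract_last k n w f = (\<lambda>y. if y \<in> box k n then (\<Sum>l<n k. w l * f (y(k := l))) else 0)"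

lemma contract_last_add:
  "contract_last k n w (\<lambda>x. f x + g x) = (\<lambda>x. contract_last k n w f x + contract_last k n w g x)"
  by (rule ext) (simp add: contract_last_def distrib_left sum.distrib)

lemma contract_last_sum:
  "contract_last k n w (\<lambda>x. \<Sum>m\<in>M. f m x) = (\<lambda>x. \<Sum>m\<in>M. contract_last k n w (f m) x)"
  by (rule ext) (simp add: contract_last_def sum_distrib_left sum.swap[of _ M])

lemma etensor_Suc_update:
  assumes "y \<in> box k n" "l < n k"
  shows "etensor (Suc k) n zs (y(k := l)) = etensor k n zs y * zs k l"
proof -
  have "(\<Prod>i<k. zs i ((y(k := l)) i)) = (\<Prod>i<k. zs i (y i))" by (rule prod.cong) auto
  then show ?thesis using box_update_Suc[OF assms] assms(1) by (simp add: etensor_def)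
qed

lemma contract_last_etensor:
  "contract_last k n w (etensor (Suc k) n zs) = (\<lambda>y. (\<Sum>l<n k. w l * zs k l) * etensor k n zs y)"
proof
  fix y
  show "contract_last k n w (etensor (Suc k) n zs) y = (\<Sum>l<n k. w l * zs k l) * etensor k n zs y"
  proof (cases "y \<in> box k n")
    case True
    then have "(\<Sum>l<n k. w l * etensor (Suc k) n zs (y(k := l)))
        = (\<Sum>l<n k. w l * (etensor k n zs y * zs k l))"
      by (intro sum.cong) (simp_all add: etensor_Suc_update)
    then show ?thesis using True by (simp add: contract_last_def sum_distrib_left mult_ac)
  qed (simp add: contract_last_def etensor_def)
qed

lemma dot_etensor_contract_last:
  "dot (Suc k) n (etensor (Suc k) n z) f = dot k n (etensor k n z) (contract_last k n (z k) f)"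
proof -
  have "dot (Suc k) n (etensor (Suc k) n z) f
      = (\<Sum>y\<in>box k n. \<Sum>j<n k. etensor (Suc k) n z (y(k := j)) * f (y(k := j)))"
    unfolding dot_def sum_box_Suc ..
  also have "\<dots> = (\<Sum>y\<in>box k n. etensor k n z y * contract_last k n (z k) f y)"
    by (rule sum.cong) (simp_all add: etensor_Suc_update contract_last_def sum_distrib_left mult.assoc)
  finally show ?thesis by (simp add: dot_def)
qed

lemma contract_last_colspace:
  assumes "i < k" "linear_subspace V" "f \<in> colspace (Suc k) n i V"
  shows "contract_last k n w f \<in> colspace k n i V"
proof -
  have "col n (contract_last k n w f) i y = (\<lambda>j. \<Sum>l<n k. w l * col n f i (y(k := l)) j)"
    if y: "y \<in> box k n" for y
  proof
    fix j
    have "j < n i \<Longrightarrow> y(i := j) \<in> box k n" using y assms(1) by (auto simp: box_def)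
    moreover have "y(i := j, k := l) = y(k := l, i := j)" for l using assms(1) by (auto simp: fun_upd_twist)
    ultimately show "col n (contract_last k n w f) i y j = (\<Sum>l<n k. w l * col n f i (y(k := l)) j)"
      by (simp add: col_def contract_last_def)
  qed
  moreover have "(\<lambda>j. \<Sum>l<n k. w l * col n f i (y(k := l)) j) \<in> V" if y: "y \<in> box k n" for y
    using assms box_update_Suc[OF y]
    by (intro linear_subspace_sum[OF assms(2)] linear_subspace_smult[OF assms(2)]) (auto simp: colspace_def)
  ultimately show ?thesis by (auto simp: colspace_def arrays_def contract_last_def)
qed

lemma contract_last_colspace_Blow:
  assumes "w \<in> Zup (n k) D" "f \<in> colspace (Suc k) n k (Blow (n k) D)"
  shows "contract_last k n w f = (\<lambda>_. 0)"
proof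
  fix y show "contract_last k n w f y = 0"
  proof (cases "y \<in> box k n \<and> 0 < n k")
    case True
    then have "y \<in> box (Suc k) n" by (auto simp: box_def less_Suc_eq)
    then have "(\<Sum>l<n k. w l * col n f k y l) = 0"
      using Zup_orthogonal_Blow[OF assms(1)] assms(2) by (simp add: colspace_def)
    then show ?thesis using True by (simp add: contract_last_def col_def)
  qed (auto simp: contract_last_def)
qed

lemma weight_contract_last:
  assumes "0 < n k"
  shows "weight k n (contract_last k n w f) \<le> colweight (Suc k) n k f"
  unfolding weight_def colweight_def
proof (rule card_mono)
  show "finite {x \<in> box (Suc k) n. x k = 0 \<and> col n f k x \<noteq> (\<lambda>_. 0)}"
    using finite_box by simp
  have "col n f k y \<noteq> (\<lambda>_. 0)" if "contract_last k n w f y \<noteq> 0" for y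
  proof
    assume "col n f k y = (\<lambda>_. 0)"
    then have "f (y(k := l)) = 0" if "l < n k" for l
      using fun_cong[of _ _ l] that by (fastforce simp: col_def)
    then have "contract_last k n w f y = 0" by (simp add: contract_last_def)
    with \<open>contract_last k n w f y \<noteq> 0\<close> show False ..
  qed
  then show "{x \<in> box k n. contract_last k n w f x \<noteq> 0}
      \<subseteq> {x \<in> box (Suc k) n. x k = 0 \<and> col n f k x \<noteq> (\<lambda>_. 0)}"
    using assms by (auto simp: box_def less_Suc_eq)
qed

lemma etensor_scale_factor:
  assumes "i < k"
  shows "etensor k n (zs(i := (\<lambda>j. c * zs i j))) = (\<lambda>y. c * etensor k n zs y)"
proof
  fix y
  have "(\<Prod>l<k. (zs(i := (\<lambda>j. c * zs i j))) l (y l)) = c * (zs i (y i) * (\<Prod>l\<in>{..<k} - {i}. zs l (y l)))"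
    using assms by (simp add: prod.remove mult.assoc)
  also have "\<dots> = c * (\<Prod>l<k. zs l (y l))"
    using assms by (simp add: prod.remove)
  finally show "etensor k n (zs(i := (\<lambda>j. c * zs i j))) y = c * etensor k n zs y"
    by (simp add: etensor_def)
qed

definition cycle_boundary_space ::
    "nat \<Rightarrow> (nat \<Rightarrow> nat) \<Rightarrow> (nat \<Rightarrow> nat \<Rightarrow> nat \<Rightarrow> 'a::comm_ring_1) \<Rightarrow> ((nat \<Rightarrow> nat) \<Rightarrow> 'a) set"
  where "cycle_boundary_space t n d =
    {(\<lambda>x. u x + v x) | u v. u \<in> tensor_space t n (\<lambda>i. Zlow (n i) (d i)) \<and>
       v \<in> subsum t (\<lambda>i. colspace t n i (Blow (n i) (d i)))}"

lemma cycle_boundary_space_elim: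
  assumes "a \<in> cycle_boundary_space t n d"
  obtains M :: nat and zs g where "\<forall>m<M. \<forall>i<t. zs m i \<in> Zlow (n i) (d i)"
    and "\<forall>i<t. g i \<in> colspace t n i (Blow (n i) (d i))"
    and "a = (\<lambda>x. (\<Sum>m<M. etensor t n (zs m) x) + (\<Sum>i<t. g i x))"
proof -
  obtain u v where a: "a = (\<lambda>x. u x + v x)" and u: "u \<in> tensor_space t n (\<lambda>i. Zlow (n i) (d i))"
    and v: "v \<in> subsum t (\<lambda>i. colspace t n i (Blow (n i) (d i)))"
    using assms unfolding cycle_boundary_space_def by blast
  obtain M :: nat and zs where "\<forall>m<M. \<forall>i<t. zs m i \<in> Zlow (n i) (d i)" "u = (\<lambda>x. \<Sum>m<M. etensor t n (zs m) x)"
    using u unfolding tensor_space_def mem_Collect_eq by auto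
  moreover obtain g where "\<forall>i<t. g i \<in> colspace t n i (Blow (n i) (d i))" "v = (\<lambda>x. \<Sum>i<t. g i x)"
    using v unfolding subsum_def by blast
  ultimately show ?thesis using that a by blast
qed

lemma cycle_boundary_space_intro:
  fixes M :: nat
  assumes "\<forall>m<M. \<forall>i<t. zs m i \<in> Zlow (n i) (d i)"
    and "\<forall>i<t. g i \<in> colspace t n i (Blow (n i) (d i))"
  shows "(\<lambda>x. (\<Sum>m<M. etensor t n (zs m) x) + (\<Sum>i<t. g i x)) \<in> cycle_boundary_space t n d"
proof -
  have "(\<lambda>x. \<Sum>m<M. etensor t n (zs m) x) \<in> tensor_space t n (\<lambda>i. Zlow (n i) (d i))"
    unfolding tensor_space_def using assms(1) by blast
  moreover have "(\<lambda>x. \<Sum>i<t. g i x) \<in> subsum t (\<lambda>i. colspace t n i (Blow (n i) (d i)))"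
    unfolding subsum_def using assms(2) by blast
  ultimately show ?thesis
    unfolding cycle_boundary_space_def
    by (intro CollectI exI[of _ "\<lambda>x. \<Sum>m<M. etensor t n (zs m) x"] exI[of _ "\<lambda>x. \<Sum>i<t. g i x"]) simp
qed

lemma cycle_boundary_space_subsum:
  assumes "is_complex (n k) (d k)" "a \<in> cycle_boundary_space (Suc k) n d"
  shows "a \<in> subsum (Suc k) (\<lambda>i. colspace (Suc k) n i (if i < k then Blow (n i) (d i) else Zlow (n i) (d i)))"
proof -
  obtain M :: nat and zs g where zs: "\<forall>m<M. \<forall>i<Suc k. zs m i \<in> Zlow (n i) (d i)"
    and g: "\<forall>i<Suc k. g i \<in> colspace (Suc k) n i (Blow (n i) (d i))"
    and a: "a = (\<lambda>x. (\<Sum>m<M. etensor (Suc k) n (zs m) x) + (\<Sum>i<Suc k. g i x))"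
    using assms(2) by (rule cycle_boundary_space_elim)
  define cs where "cs = g(k := (\<lambda>x. (\<Sum>m<M. etensor (Suc k) n (zs m) x) + g k x))"
  have "(\<lambda>x. \<Sum>m<M. etensor (Suc k) n (zs m) x) \<in> colspace (Suc k) n k (Zlow (n k) (d k))"
    using zs by (intro colspace_sum[OF linear_subspace_Zlow] etensor_colspace[OF _ linear_subspace_Zlow]) (auto simp: Zlow_def)
  moreover have "g k \<in> colspace (Suc k) n k (Zlow (n k) (d k))"
    using g colspace_mono[OF Blow_subset_Zlow[OF assms(1)]] by blast
  ultimately have "cs k \<in> colspace (Suc k) n k (Zlow (n k) (d k))"
    using colspace_sum[OF linear_subspace_Zlow, of "{0, 1 :: nat}"
        "\<lambda>m. if m = 0 then (\<lambda>x. \<Sum>m<M. etensor (Suc k) n (zs m) x) else g k"] by (simp add: cs_def)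
  then have "\<forall>i<Suc k. cs i \<in> colspace (Suc k) n i (if i < k then Blow (n i) (d i) else Zlow (n i) (d i))"
    using g by (simp add: cs_def less_Suc_eq)
  moreover have "a = (\<lambda>x. \<Sum>i<Suc k. cs i x)"
    by (simp add: a cs_def add_ac)
  ultimately show ?thesis unfolding subsum_def by blast
qed

lemma contract_last_cycle_boundary_space:
  assumes "0 < k" "z \<in> Zup (n k) (d k)" "a \<in> cycle_boundary_space (Suc k) n d"
    and cs: "\<forall>i<k. cs i \<in> colspace (Suc k) n i (Blow (n i) (d i))"
    and a_cs: "a = (\<lambda>x. \<Sum>i<Suc k. cs i x)"
  shows "contract_last k n z (cs k) \<in> cycle_boundary_space k n d"
proof -
  let ?C = "contract_last k n z"
  obtain M :: nat and zs g where zs: "\<forall>m<M. \<forall>i<Suc k. zs m i \<in> Zlow (n i) (d i)"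
    and g: "\<forall>i<Suc k. g i \<in> colspace (Suc k) n i (Blow (n i) (d i))"
    and a: "a = (\<lambda>x. (\<Sum>m<M. etensor (Suc k) n (zs m) x) + (\<Sum>i<Suc k. g i x))"
    using assms(3) by (rule cycle_boundary_space_elim)
  define zs' where "zs' m = (zs m)(0 := (\<lambda>j. (\<Sum>l<n k. z l * zs m k l) * zs m 0 j))" for m
  have tensor: "(\<lambda>x. \<Sum>m<M. ?C (etensor (Suc k) n (zs m)) x) = (\<lambda>x. \<Sum>m<M. etensor k n (zs' m) x)"
    unfolding contract_last_etensor zs'_def etensor_scale_factor[OF assms(1)] ..
  have "?C (g k) = (\<lambda>_. 0)"
    using contract_last_colspace_Blow assms(2) g by blast
  then have "?C a = (\<lambda>x. (\<Sum>m<M. etensor k n (zs' m) x) + (\<Sum>i<k. ?C (g i) x))"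
    unfolding a contract_last_add contract_last_sum tensor by simp
  moreover have "?C a = (\<lambda>x. (\<Sum>i<k. ?C (cs i) x) + ?C (cs k) x)"
    unfolding a_cs contract_last_sum by simp
  ultimately have "?C (cs k) = (\<lambda>x. (\<Sum>m<M. etensor k n (zs' m) x) + (\<Sum>i<k. ?C (g i) x - ?C (cs i) x))"
    by (simp add: fun_eq_iff sum_subtractf algebra_simps)
  moreover have "\<forall>m<M. \<forall>i<k. zs' m i \<in> Zlow (n i) (d i)"
    using zs by (auto simp: zs'_def intro: linear_subspace_smult[OF linear_subspace_Zlow])
  moreover have "\<forall>i<k. (\<lambda>x. ?C (g i) x - ?C (cs i) x) \<in> colspace k n i (Blow (n i) (d i))"
    using g cs by (auto intro!: colspace_diff[OF linear_subspace_Blow] contract_last_colspace[OF _ linear_subspace_Blow])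
  ultimately show ?thesis
    using cycle_boundary_space_intro[where zs=zs' and g="\<lambda>i x. ?C (g i) x - ?C (cs i) x"] by simp
qed

lemma dot_etensor_contract_last_decomposition:
  assumes "\<forall>i<k. z i \<in> Zup (n i) (d i)"
    and "\<forall>i<k. cs i \<in> colspace (Suc k) n i (Blow (n i) (d i))"
  shows "dot k n (etensor k n z) (contract_last k n (z k) (cs k))
    = dot (Suc k) n (etensor (Suc k) n z) (\<lambda>x. \<Sum>i<Suc k. cs i x)"
proof -
  have "dot (Suc k) n (etensor (Suc k) n z) (cs i) = 0" if "i < k" for i
    using that assms by (intro dot_etensor_colspace_Blow[where i=i and D="d i"]) auto
  then have "dot (Suc k) n (etensor (Suc k) n z) (\<lambda>x. \<Sum>i<Suc k. cs i x)
      = dot (Suc k) n (etensor (Suc k) n z) (cs k)"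
    unfolding dot_sum by simp
  then show ?thesis
    by (simp only: dot_etensor_contract_last)
qed

lemma contraction_step:
  fixes d :: "nat \<Rightarrow> nat \<Rightarrow> nat \<Rightarrow> 'a::comm_ring_1"
  assumes complex: "is_complex (n k) (d k)" and z: "\<forall>i<Suc k. z i \<in> Zup (n i) (d i)"
    and a: "a \<in> cycle_boundary_space (Suc k) n d"
    and dot_a: "dot (Suc k) n (etensor (Suc k) n z) a \<noteq> 0"
    and pe: "pe_good (Suc k) n (\<lambda>j. if j < k then Blow (n j) (d j) else Zlow (n j) (d j)) \<rho>"
  obtains b where "0 < k \<longrightarrow> b \<in> cycle_boundary_space k n d"
    and "dot k n (etensor k n z) b \<noteq> 0"
    and "\<rho> * real (n k) * real (weight k n b) \<le> real (weight (Suc k) n a)"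
proof -
  obtain cs where cs: "\<forall>i<Suc k. cs i \<in> colspace (Suc k) n i (if i < k then Blow (n i) (d i) else Zlow (n i) (d i))"
    and a_cs: "a = (\<lambda>x. \<Sum>i<Suc k. cs i x)"
    and weight_a: "\<rho> * (\<Sum>i<Suc k. real (n i) * real (colweight (Suc k) n i (cs i))) \<le> real (weight (Suc k) n a)"
    using pe cycle_boundary_space_subsum[OF complex a] unfolding pe_good_def by blast
  have "0 \<le> \<rho>" using pe by (simp add: pe_good_def)
  have cs_Blow: "\<forall>i<k. cs i \<in> colspace (Suc k) n i (Blow (n i) (d i))"
  proof (intro allI impI)
    fix i assume "i < k"
    then show "cs i \<in> colspace (Suc k) n i (Blow (n i) (d i))" using cs[rule_format, of i] by simp
  qed
  define b where "b = contract_last k n (z k) (cs k)"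
  have "0 < k \<longrightarrow> b \<in> cycle_boundary_space k n d"
    using contract_last_cycle_boundary_space[of k "z k" n d a cs] z a cs_Blow a_cs by (simp add: b_def)
  moreover have "dot k n (etensor k n z) b \<noteq> 0"
    using dot_etensor_contract_last_decomposition[OF _ cs_Blow, of z] z dot_a a_cs by (simp add: b_def)
  moreover have "\<rho> * real (n k) * real (weight k n b) \<le> real (weight (Suc k) n a)"
  proof -
    have "weight k n b \<le> colweight (Suc k) n k (cs k)"
      unfolding b_def by (rule weight_contract_last[where n=n and k=k, OF dim_pos_if_dot_nonzero[OF dot_a lessI]])
    then have "\<rho> * real (n k) * real (weight k n b) \<le> \<rho> * (real (n k) * real (colweight (Suc k) n k (cs k)))"
      using \<open>0 \<le> \<rho>\<close> by (simp add: mult.assoc mult_left_mono)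
    also have "\<dots> \<le> \<rho> * (\<Sum>i<Suc k. real (n i) * real (colweight (Suc k) n i (cs i)))"
      using \<open>0 \<le> \<rho>\<close> by (intro mult_left_mono member_le_sum) auto
    finally show ?thesis using weight_a by linarith
  qed
  ultimately show ?thesis using that by blast
qed

lemma cSup_mult_le:
  fixes S :: "real set"
  assumes "0 \<in> S" "\<And>\<rho>. \<rho> \<in> S \<Longrightarrow> \<rho> \<le> B" "\<And>\<rho>. \<rho> \<in> S \<Longrightarrow> \<rho> * c \<le> W"
    and "0 \<le> W"
  shows "Sup S * c \<le> W"
proof (cases "0 < c")
  case True
  have "Sup S \<le> W / c"
    using assms(1,3) True by (intro cSup_least) (auto simp: pos_le_divide_eq)
  then show ?thesis using True by (simp add: pos_le_divide_eq)
next
  case False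
  have "0 \<le> Sup S" using assms(1,2) by (intro cSup_upper2[of 0]) (auto simp: bdd_above_def)
  then show ?thesis using False assms(4) by (smt (verit) mult_nonneg_nonpos)
qed

lemma pe_good_zero: "pe_good t n V 0"
  unfolding pe_good_def subsum_def by auto

text \<open>In dimension 0, \<open>tensor_space\<close> only contains the natural-number multiples of the unit
  array, so a contraction into dimension 0 need not lie in it; hence the hypothesis on \<open>a\<close>
  is only imposed for \<open>t > 0\<close>.\<close>

lemma prod_product_expansion_le_weight:
  fixes d :: "nat \<Rightarrow> nat \<Rightarrow> nat \<Rightarrow> 'a::comm_ring_1"
  assumes "\<forall>i<t. is_complex (n i) (d i)" "\<forall>i<t. z i \<in> Zup (n i) (d i)"
    and "0 < t \<longrightarrow> a \<in> cycle_boundary_space t n d"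
    and "dot t n (etensor t n z) a \<noteq> 0"
  shows "(\<Prod>i<t. product_expansion (Suc i) n
      (\<lambda>j. if j < i then Blow (n j) (d j) else Zlow (n j) (d j)) * real (n i)) \<le> real (weight t n a)"
  using assms
proof (induction t arbitrary: a)
  case 0
  then show ?case using weight_pos_if_dot_nonzero[OF "0.prems"(4)] by simp
next
  case (Suc k)
  let ?V = "\<lambda>j. if j < k then Blow (n j) (d j) else Zlow (n j) (d j)"
  define P where "P = (\<Prod>i<k. product_expansion (Suc i) n
      (\<lambda>j. if j < i then Blow (n j) (d j) else Zlow (n j) (d j)) * real (n i))"
  define W where "W = real (weight (Suc k) n a)"
  have "\<rho> \<le> W \<and> \<rho> * (real (n k) * P) \<le> W" if pe: "pe_good (Suc k) n ?V \<rho>" for \<rho>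
  proof -
    obtain b where "0 < k \<longrightarrow> b \<in> cycle_boundary_space k n d" and dot_b: "dot k n (etensor k n z) b \<noteq> 0"
      and weight_b: "\<rho> * real (n k) * real (weight k n b) \<le> W"
      using contraction_step[OF _ _ _ _ pe] Suc.prems unfolding W_def by auto
    then have P_b: "P \<le> real (weight k n b)"
      using Suc.IH[of b] Suc.prems unfolding P_def by simp
    have "0 \<le> \<rho>" using pe by (simp add: pe_good_def)
    have "1 \<le> real (n k)" "1 \<le> real (weight k n b)"
      using dim_pos_if_dot_nonzero[OF Suc.prems(4) lessI] weight_pos_if_dot_nonzero[OF dot_b] by simp_all
    then have "1 \<le> real (n k) * real (weight k n b)"
      using mult_mono[of 1 "real (n k)" 1 "real (weight k n b)"] by simp
    then have "\<rho> \<le> \<rho> * real (n k) * real (weight k n b)"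
      using \<open>0 \<le> \<rho>\<close> by (simp add: mult.assoc mult_le_cancel_left1)
    moreover have "\<rho> * (real (n k) * P) \<le> \<rho> * real (n k) * real (weight k n b)"
      using \<open>0 \<le> \<rho>\<close> P_b by (simp add: mult.assoc mult_left_mono)
    ultimately show ?thesis using weight_b by linarith
  qed
  then have "Sup {\<rho>. pe_good (Suc k) n ?V \<rho>} * (real (n k) * P) \<le> W"
    by (intro cSup_mult_le[where B=W]) (auto simp: pe_good_zero W_def)
  then show ?case
    by (simp add: product_expansion_def P_def W_def mult_ac)
qed

theorem lemma4p6:
  fixes t :: nat and n :: "nat \<Rightarrow> nat"
    and d :: "nat \<Rightarrow> nat \<Rightarrow> nat \<Rightarrow> 'a::{finite,field}"
    and a :: "(nat \<Rightarrow> nat) \<Rightarrow> 'a" and z :: "nat \<Rightarrow> nat \<Rightarrow> 'a"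
  assumes "CHAR('a) = 2"
    and "\<forall>i<t. is_complex (n i) (d i)"
    and "a \<in> {(\<lambda>x. u x + v x) | u v. u \<in> tensor_space t n (\<lambda>i. Zlow (n i) (d i)) \<and>
                          v \<in> subsum t (\<lambda>i. colspace t n i (Blow (n i) (d i)))}"
    and "\<forall>i<t. z i \<in> Zup (n i) (d i)"
    and "dot t n (etensor t n z) a \<noteq> 0"
  shows "real (weight t n a) \<ge>
    (\<Prod>i<t. product_expansion (Suc i) n
               (\<lambda>j. if j < i then Blow (n j) (d j) else Zlow (n j) (d j)) * real (n i))"
  using prod_product_expansion_le_weight[OF assms(2) assms(4) _ assms(5)] assms(3)
  by (simp add: cycle_boundary_space_def)

end
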